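(* Let $G$ be a graph of order $n\ge 3$ with minimum degree $\delta(G)=1$ and with exactly one full vertex. Then $\mathcal{C}(G)=n$ if and only if $G$ is obtained from the graph $K_1\cup K_{n-1}$ by adding an edge joining the isolated vertex to an arbitrary vertex of the complete graph $K_{n-1}$.
   Context: All graphs are finite and simple. For a graph $G$ with vertex set $V$, a set $S\subseteq V$ is a dominating set if every vertex of $V\setminus S$ is adjacent to a vertex of $S$. Two disjoint sets $V_1,V_2\subseteq V$ form a coalition in $G$ if neither is a dominating set of $G$ but $V_1\cup V_2$ is. A coalition partition of $G$ is a partition $\Psi=\{V_1,\ldots,V_k\}$ of $V$ such that every $V_i\in\Psi$ is either a dominating set of $G$ with $|V_i|=1$, or is not a dominating set and forms a coalition with some $V_j\in\Psi$. The coalition number $\mathcal{C}(G)$ is the maximum cardinality of a coalition partition of $G$. The order is $n=|V|$; a full vertex is a vertex of degree $n-1$. *)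

theory Defs
  imports "Graph_Theory.Graph_Theory" "HOL-Library.Disjoint_Sets"
begin

text \<open>
  A finite simple graph is a \<^locale>\<open>pair_graph\<close>: a finite, loop-free, symmetric set of pairs on a
  finite vertex set. The undirected edge \<open>uv\<close> is the pair of arcs \<open>(u, v)\<close>, \<open>(v, u)\<close>, so
  the degree of a vertex is its out-degree.
\<close>

definition degree :: "'a pair_pre_digraph \<Rightarrow> 'a \<Rightarrow> nat" where
  "degree G v = out_degree (with_proj G) v"

definition min_degree :: "'a pair_pre_digraph \<Rightarrow> nat" where
  "min_degree G = Min (degree G ` pverts G)"

definition full_vertex :: "'a pair_pre_digraph \<Rightarrow> 'a \<Rightarrow> bool" where
  "full_vertex G v \<longleftrightarrow> v \<in> pverts G \<and> degree G v = card (pverts G) - 1"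

definition dominating_set :: "'a pair_pre_digraph \<Rightarrow> 'a set \<Rightarrow> bool" where
  "dominating_set G S \<longleftrightarrow>
     S \<subseteq> pverts G \<and> (\<forall>v \<in> pverts G - S. \<exists>u \<in> S. (v, u) \<in> parcs G)"

definition coalition :: "'a pair_pre_digraph \<Rightarrow> 'a set \<Rightarrow> 'a set \<Rightarrow> bool" where
  "coalition G A B \<longleftrightarrow>
     A \<subseteq> pverts G \<and> B \<subseteq> pverts G \<and> A \<inter> B = {} \<and>
     \<not> dominating_set G A \<and> \<not> dominating_set G B \<and> dominating_set G (A \<union> B)"

definition coalition_partition :: "'a pair_pre_digraph \<Rightarrow> 'a set set \<Rightarrow> bool" where
  "coalition_partition G P \<longleftrightarrow>
     partition_on (pverts G) P \<and>
     (\<forall>A \<in> P. (dominating_set G A \<and> card A = 1) \<or>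
              (\<not> dominating_set G A \<and> (\<exists>B \<in> P. coalition G A B)))"

text \<open>
  The maximum is over a finite set, and that set is non-empty because every finite simple graph
  has a coalition partition (Haynes et al., 2020).
\<close>

definition coalition_number :: "'a pair_pre_digraph \<Rightarrow> nat" where
  "coalition_number G = Max {card P | P. coalition_partition G P}"

definition add_edge :: "('a, 'a \<times> 'a) pre_digraph \<Rightarrow> 'a \<Rightarrow> 'a \<Rightarrow> ('a, 'a \<times> 'a) pre_digraph" where
  "add_edge H u v = pre_digraph.add_arc (pre_digraph.add_arc H (u, v)) (v, u)"

text \<open>
  Here \<open>K\<^bsub>m\<^esub> H\<close> says that \<open>H\<close> is some complete graph on \<open>m\<close> vertices. Since the two complete graphs
  range over all vertex sets in \<open>'a\<close>, equality with \<open>G\<close> already means ``up to isomorphism''.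
\<close>

definition complete_with_pendant :: "nat \<Rightarrow> 'a pair_pre_digraph \<Rightarrow> bool" where
  "complete_with_pendant n G \<longleftrightarrow>
     (\<exists>H\<^sub>1 H\<^sub>2 :: 'a pair_pre_digraph. \<exists>u v.
        K\<^bsub>1\<^esub> (with_proj H\<^sub>1) \<and> K\<^bsub>n - 1\<^esub> (with_proj H\<^sub>2) \<and> pverts H\<^sub>1 \<inter> pverts H\<^sub>2 = {} \<and>
        u \<in> pverts H\<^sub>1 \<and> v \<in> pverts H\<^sub>2 \<and>
        with_proj G = add_edge (union (with_proj H\<^sub>1) (with_proj H\<^sub>2)) u v)"

end

theory Submission
  imports Defs
begin

text \<open>
  Since a coalition partition with \<open>n\<close> blocks consists of singletons, \<open>\<C>(G) = n\<close> means that the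
  partition into singletons is a coalition partition. Let \<open>u\<close> be a leaf and \<open>v\<close> its only neighbour,
  the full vertex. A vertex \<open>w\<close> other than \<open>u\<close> and \<open>v\<close> needs a partner that together with \<open>w\<close> dominates
  \<open>u\<close>; as \<open>{v}\<close> is dominating, the partner can only be \<open>u\<close>. Hence \<open>{w, u}\<close> dominates, so \<open>w\<close> is
  adjacent to every vertex but \<open>u\<close>. Conversely, in a complete graph with a pendant vertex \<open>u\<close>, every
  singleton other than \<open>{v}\<close> and \<open>{u}\<close> forms a coalition with \<open>{u}\<close>.
  The maximum defining \<open>\<C>(G)\<close> is over a non-empty set because \<open>{{v}, {u}, V - {u, v}}\<close> is a
  coalition partition.
\<close>

lemma card_partition_on:
  assumes "finite A" "partition_on A P"
  shows "card A = sum card P"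
proof -
  have "\<And>B. B \<in> P \<Longrightarrow> finite B"
    using assms by (metis Union_upper finite_subset partition_onD1)
  then have "card (\<Union>P) = sum card P"
    using partition_onD2[OF assms(2)]
    by (intro card_Union_disjoint) (auto simp: disjoint_def pairwise_def disjnt_def)
  then show ?thesis
    using partition_onD1[OF assms(2)] by simp
qed

lemma card_partition_on_member_pos:
  assumes "finite A" "partition_on A P" "B \<in> P"
  shows "1 \<le> card B"
proof -
  have "finite B" using assms by (metis Union_upper finite_subset partition_onD1)
  moreover have "B \<noteq> {}" using assms partition_onD3 by blast
  ultimately show ?thesis by (simp add: Suc_le_eq card_gt_0_iff)
qed

lemma card_partition_on_le:
  assumes "finite A" "partition_on A P"
  shows "card P \<le> card A"
proof -
  have "card P = (\<Sum>B\<in>P. 1)" by simp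
  also have "\<dots> \<le> sum card P"
    using card_partition_on_member_pos[OF assms] by (intro sum_mono)
  finally show ?thesis using card_partition_on[OF assms] by simp
qed

text \<open>The block sizes sum to \<open>card A\<close> and each is at least 1, so with
  \<open>card A\<close> blocks every one of these inequalities is tight.\<close>

lemma partition_on_card_eq_singletons:
  assumes "finite A" "partition_on A P" "card P = card A"
  shows "P = (\<lambda>x. {x}) ` A"
proof -
  have fin: "finite P" using assms finite_elements by blast
  have "(\<Sum>B\<in>P. 1) = sum card P"
    using card_partition_on[OF assms(1,2)] assms(3) by simp
  then have one: "card B = 1" if "B \<in> P" for B
    using sum_mono_inv[of "\<lambda>_. 1" P card B] card_partition_on_member_pos[OF assms(1,2)] fin that
    by simp
  have A: "A = \<Union>P" using assms(2) by (rule partition_onD1)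
  show ?thesis
  proof
    show "P \<subseteq> (\<lambda>x. {x}) ` A"
      using one A by (auto simp: card_1_singleton_iff) (metis UnionI image_eqI singletonI)
    show "(\<lambda>x. {x}) ` A \<subseteq> P"
      using one A by (auto simp: card_1_singleton_iff)
  qed
qed

lemma ex_in_Diff_doubleton:
  assumes "card A \<ge> 3"
  shows "\<exists>c. c \<in> A - {a, b}"
proof (rule ccontr)
  assume "\<not> ?thesis"
  then have "card A \<le> card {a, b}" by (intro card_mono) auto
  also have "\<dots> \<le> 2" by (simp add: card_insert_if)
  finally show False using assms by simp
qed

text \<open>\<open>P\<^sub>0\<close> makes the set under \<open>Max\<close> non-empty and
  \<open>card (pverts G)\<close> bounds it, so the maximum equals this bound iff the bound is
  attained, which only the partition into singletons can do.\<close>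

lemma coalition_number_eq_card_iff:
  assumes fin: "finite (pverts G)" and ex: "coalition_partition G P\<^sub>0"
  shows "coalition_number G = card (pverts G) \<longleftrightarrow>
    coalition_partition G ((\<lambda>x. {x}) ` pverts G)"
proof -
  define S where "S = {card P | P. coalition_partition G P}"
  have le: "k \<le> card (pverts G)" if "k \<in> S" for k
    using that card_partition_on_le[OF fin] by (auto simp: S_def coalition_partition_def)
  then have "finite S" using finite_nat_set_iff_bounded_le by blast
  moreover have "S \<noteq> {}" using ex by (auto simp: S_def)
  ultimately have "Max S = card (pverts G) \<longleftrightarrow> card (pverts G) \<in> S"
    using le by (metis Max_eqI Max_in)
  also have "\<dots> \<longleftrightarrow> coalition_partition G ((\<lambda>x. {x}) ` pverts G)"
  proof
    assume "card (pverts G) \<in> S"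
    then obtain P where "coalition_partition G P" "card P = card (pverts G)"
      by (auto simp: S_def)
    then show "coalition_partition G ((\<lambda>x. {x}) ` pverts G)"
      using partition_on_card_eq_singletons[OF fin] by (metis coalition_partition_def)
  next
    assume "coalition_partition G ((\<lambda>x. {x}) ` pverts G)"
    then show "card (pverts G) \<in> S"
      by (auto simp: S_def card_image intro!: exI[of _ "(\<lambda>x. {x}) ` pverts G"])
  qed
  finally show ?thesis by (simp add: coalition_number_def S_def)
qed

lemma degree_eq_card_Image: "degree G v = card (parcs G `` {v})"
proof -
  have "out_arcs (with_proj G) v = Pair v ` (parcs G `` {v})"
    by (auto simp: out_arcs_def)
  then show ?thesis
    by (simp add: degree_def out_degree_def card_image inj_on_def)
qed

text \<open>Without loops the neighbourhood of \<open>v\<close> lies in the finite set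
  \<open>pverts G - {v}\<close>, so equal cardinality forces equality.\<close>

lemma full_vertex_iff:
  assumes "pair_graph G"
  shows "full_vertex G v \<longleftrightarrow> v \<in> pverts G \<and> (\<forall>w \<in> pverts G - {v}. (v, w) \<in> parcs G)"
proof (cases "v \<in> pverts G")
  case True
  interpret pair_graph G by fact
  have sub: "parcs G `` {v} \<subseteq> pverts G - {v}"
    using in_arcsD2 no_loops' by auto
  have "degree G v = card (pverts G - {v}) \<longleftrightarrow> parcs G `` {v} = pverts G - {v}"
    using sub pair_finite_verts card_subset_eq[of "pverts G - {v}" "parcs G `` {v}"]
    by (metis degree_eq_card_Image finite_Diff)
  then show ?thesis
    using True sub by (auto simp: full_vertex_def)
qed (simp add: full_vertex_def)

text \<open>Domination uses arcs into \<open>v\<close> and degree uses arcs out of \<open>v\<close>;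
  symmetry reconciles them.\<close>

lemma dominating_singleton_iff_full_vertex:
  assumes "pair_graph G"
  shows "dominating_set G {v} \<longleftrightarrow> full_vertex G v"
proof -
  interpret pair_graph G by fact
  show ?thesis
    using arcs_symmetric by (auto simp: dominating_set_def full_vertex_iff[OF assms])
qed

lemma complete_with_pendant_iff:
  assumes "finite (pverts G)" "card (pverts G) = n"
  shows "complete_with_pendant n G \<longleftrightarrow>
    (\<exists>u \<in> pverts G. \<exists>v \<in> pverts G - {u}.
       parcs G = {(x, y). x \<in> pverts G - {u} \<and> y \<in> pverts G - {u} \<and> x \<noteq> y} \<union> {(u, v), (v, u)})"
    (is "_ \<longleftrightarrow> ?R")
proof
  assume "complete_with_pendant n G"
  then obtain H1 H2 :: "'a pair_pre_digraph" and u v where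
    H1: "K\<^bsub>1\<^esub> (with_proj H1)" and H2: "K\<^bsub>n - 1\<^esub> (with_proj H2)"
    and disj: "pverts H1 \<inter> pverts H2 = {}" and u: "u \<in> pverts H1" and v: "v \<in> pverts H2"
    and G: "with_proj G = add_edge (union (with_proj H1) (with_proj H2)) u v"
    unfolding complete_with_pendant_def by blast
  have H1': "pverts H1 = {u}" "parcs H1 = {}"
    using H1 u by (auto simp: complete_digraph_pair_def card_1_singleton_iff)
  have H2': "parcs H2 = {(x, y). x \<in> pverts H2 \<and> y \<in> pverts H2 \<and> x \<noteq> y}"
    using H2 by (auto simp: complete_digraph_pair_def)
  have "pverts G = pverts H1 \<union> pverts H2" "parcs G = parcs H1 \<union> parcs H2 \<union> {(u, v), (v, u)}"
    using arg_cong[OF G, of verts] arg_cong[OF G, of arcs] u v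
    by (auto simp: add_edge_def union_def pre_digraph.add_arc_def)
  then have G': "pverts G = insert u (pverts H2)" "parcs G = parcs H2 \<union> {(u, v), (v, u)}"
    using H1' by simp_all
  \<comment> \<open>Disjointness keeps \<open>u\<close> out of the larger complete graph.\<close>
  moreover have "pverts G - {u} = pverts H2" using G'(1) disj H1' by auto
  ultimately have "u \<in> pverts G" "v \<in> pverts G - {u}"
    "parcs G = {(x, y). x \<in> pverts G - {u} \<and> y \<in> pverts G - {u} \<and> x \<noteq> y} \<union> {(u, v), (v, u)}"
    using H2' v by simp_all
  then show ?R by blast
next
  assume ?R
  then obtain u v where u: "u \<in> pverts G" and v: "v \<in> pverts G - {u}" and
    E: "parcs G = {(x, y). x \<in> pverts G - {u} \<and> y \<in> pverts G - {u} \<and> x \<noteq> y} \<union> {(u, v), (v, u)}"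
    by blast
  define H1 :: "'a pair_pre_digraph" where "H1 = \<lparr>pverts = {u}, parcs = {}\<rparr>"
  define H2 :: "'a pair_pre_digraph" where "H2 = \<lparr>pverts = pverts G - {u},
    parcs = {(x, y). x \<in> pverts G - {u} \<and> y \<in> pverts G - {u} \<and> x \<noteq> y}\<rparr>"
  have "K\<^bsub>1\<^esub> (with_proj H1)" "K\<^bsub>n - 1\<^esub> (with_proj H2)"
    using assms u by (auto simp: complete_digraph_pair_def H1_def H2_def)
  moreover have "with_proj G = add_edge (union (with_proj H1) (with_proj H2)) u v"
    using u v E
    by (auto simp: add_edge_def union_def pre_digraph.add_arc_def with_proj_def H1_def H2_def)
  ultimately show "complete_with_pendant n G"
    unfolding complete_with_pendant_def using v
    by (intro exI[of _ H1] exI[of _ H2] exI[of _ u] exI[of _ v]) (auto simp: H1_def H2_def)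
qed

lemma coalition_partition_singletons_iff:
  "coalition_partition G ((\<lambda>x. {x}) ` pverts G) \<longleftrightarrow>
    (\<forall>x \<in> pverts G. dominating_set G {x} \<or> (\<exists>y \<in> pverts G. coalition G {x} {y}))"
  by (auto simp: coalition_partition_def partition_on_singletons coalition_def)

text \<open>\<open>W\<close> fails to dominate \<open>u\<close>, whose only neighbour is
  \<open>v\<close>, and \<open>{u}\<close> fails to dominate any vertex of \<open>W\<close>. Their
  union omits only \<open>v\<close>, which is adjacent to \<open>u\<close>.\<close>

lemma ex_coalition_partition:
  assumes uv: "u \<in> pverts G" "v \<in> pverts G" "u \<noteq> v"
    and large: "card (pverts G) \<ge> 3"
    and dom: "dominating_set G {v}"
    and nb: "\<And>x. (u, x) \<in> parcs G \<longleftrightarrow> x = v" "\<And>x. (x, u) \<in> parcs G \<longleftrightarrow> x = v"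
  shows "\<exists>P. coalition_partition G P"
proof -
  define W where "W = pverts G - {u, v}"
  obtain w where w: "w \<in> W"
    using ex_in_Diff_doubleton[OF large] unfolding W_def by blast
  have "partition_on (pverts G) {{v}, {u}, W}"
    using uv w by (auto simp: partition_on_def disjoint_def W_def)
  moreover have "coalition G {u} W"
    using uv w dom nb by (auto simp: coalition_def dominating_set_def W_def)
  moreover from this have "coalition G W {u}"
    by (simp add: coalition_def Int_commute Un_commute)
  ultimately have "coalition_partition G {{v}, {u}, W}"
    using dom by (auto simp: coalition_partition_def coalition_def)
  then show ?thesis ..
qed

theorem theorem6:
  fixes G :: "'a pair_pre_digraph" and n :: nat
  assumes "pair_graph G"
    and "card (pverts G) = n"
    and "n \<ge> 3"
    and "min_degree G = 1"
    and "\<exists>!v. full_vertex G v"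
  shows "coalition_number G = n \<longleftrightarrow> complete_with_pendant n G"
proof -
  interpret pair_graph G by fact
  note fin = pair_finite_verts
  obtain v where v: "full_vertex G v" and uniq: "\<And>w. full_vertex G w \<Longrightarrow> w = v"
    using assms(5) by blast
  \<comment> \<open>This degree is \<open>n - 1\<close>, hence at least 2, which separates
    \<open>v\<close> from the leaf \<open>u\<close> chosen below.\<close>
  have "degree G v \<noteq> 1"
    using v assms(2,3) by (simp add: full_vertex_def)
  have "pverts G \<noteq> {}" using assms(2,3) by auto
  then have "1 \<in> degree G ` pverts G"
    using assms(4) fin by (metis Min_in finite_imageI image_is_empty min_degree_def)
  then obtain u where u: "u \<in> pverts G" "degree G u = 1" by auto
  have "u \<noteq> v" using u \<open>degree G v \<noteq> 1\<close> by auto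
  have vV: "v \<in> pverts G" and v_adj: "\<And>w. w \<in> pverts G \<Longrightarrow> w \<noteq> v \<Longrightarrow> (v, w) \<in> parcs G"
    using v full_vertex_iff[OF assms(1)] by auto
  have "(u, v) \<in> parcs G" using v_adj u \<open>u \<noteq> v\<close> arcs_symmetric by blast
  moreover obtain z where "parcs G `` {u} = {z}"
    using u by (metis degree_eq_card_Image card_1_singletonE)
  ultimately have nb: "(u, x) \<in> parcs G \<longleftrightarrow> x = v" for x
    by (metis Image_singleton_iff singleton_iff)
  then have nb': "(x, u) \<in> parcs G \<longleftrightarrow> x = v" for x
    using arcs_symmetric by blast
  have dom: "dominating_set G {x} \<longleftrightarrow> x = v" for x
    using dominating_singleton_iff_full_vertex[OF assms(1)] v uniq by blast
  have "\<exists>P. coalition_partition G P"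
    using u(1) vV \<open>u \<noteq> v\<close> _ _ nb nb'
    by (rule ex_coalition_partition) (simp_all add: assms(2,3) dom)
  then obtain P\<^sub>0 where "coalition_partition G P\<^sub>0" ..
  from coalition_number_eq_card_iff[OF fin this]
  have "coalition_number G = n \<longleftrightarrow> coalition_partition G ((\<lambda>x. {x}) ` pverts G)"
    unfolding assms(2) .
  also have "\<dots> \<longleftrightarrow> complete_with_pendant n G"
  proof
    assume "coalition_partition G ((\<lambda>x. {x}) ` pverts G)"
    then have coal: "\<exists>y \<in> pverts G. coalition G {w} {y}" if "w \<in> pverts G" "w \<noteq> v" for w
      using that dom by (auto simp: coalition_partition_singletons_iff)
    have adj: "(w, x) \<in> parcs G"
      if w: "w \<in> pverts G" "w \<noteq> u" and x: "x \<in> pverts G" "x \<noteq> u" "x \<noteq> w" for w x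
    proof (cases "w = v")
      case False
      then obtain y where y: "coalition G {w} {y}" using coal w by blast
      \<comment> \<open>Members of a coalition do not dominate, whereas \<open>{v}\<close>
        does.\<close>
      then have "y \<noteq> v" "dominating_set G {w, y}"
        using dom by (auto simp: coalition_def insert_commute)
      \<comment> \<open>The pair must contain \<open>u\<close> or its only neighbour
        \<open>v\<close>; both \<open>w\<close> and \<open>y\<close> differ from \<open>v\<close>,
        and \<open>w\<close> differs from \<open>u\<close>.\<close>
      then have "y = u" using False w nb u by (auto simp: dominating_set_def)
      then have "dominating_set G {w, u}" using \<open>dominating_set G {w, y}\<close> by simp
      \<comment> \<open>If \<open>u\<close> rather than \<open>w\<close> dominates \<open>x\<close>,
        then \<open>x\<close> is the only neighbour of \<open>u\<close>.\<close>
      then have "(x, w) \<in> parcs G \<or> x = v"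
        using x nb' by (auto simp: dominating_set_def)
      then show ?thesis using arcs_symmetric v_adj w False by blast
    qed (use v_adj x in auto)
    have "(x, y) \<in> parcs G \<longleftrightarrow> (x, y) \<in> {(x, y). x \<in> pverts G - {u} \<and> y \<in> pverts G - {u} \<and> x \<noteq> y}
        \<union> {(u, v), (v, u)}" for x y
    proof (cases "x = u \<or> y = u")
      case True
      then show ?thesis using nb[of y] nb'[of x] by auto
    next
      case False
      then show ?thesis using adj[of x y] in_arcsD1[of x y] in_arcsD2[of x y] no_loops'[of x y] by auto
    qed
    then have "parcs G = {(x, y). x \<in> pverts G - {u} \<and> y \<in> pverts G - {u} \<and> x \<noteq> y} \<union> {(u, v), (v, u)}"
      by (intro set_eqI) (simp only: split_paired_all)
    then show "complete_with_pendant n G"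
      unfolding complete_with_pendant_iff[OF fin assms(2)]
      using u(1) vV \<open>u \<noteq> v\<close> by (intro bexI[of _ u] bexI[of _ v]) simp_all
  next
    assume "complete_with_pendant n G"
    then obtain a b where a: "a \<in> pverts G" and b: "b \<in> pverts G - {a}" and
      E: "parcs G = {(x, y). x \<in> pverts G - {a} \<and> y \<in> pverts G - {a} \<and> x \<noteq> y} \<union> {(a, b), (b, a)}"
      unfolding complete_with_pendant_iff[OF fin assms(2)] by (elim bexE)
    \<comment> \<open>The pendant edge reaches \<open>a\<close> and the complete graph covers the
      rest; uniqueness of the full vertex then identifies \<open>b\<close> with
      \<open>v\<close>.\<close>
    have "dominating_set G {b}"
      using a b E by (auto simp: dominating_set_def)
    then have "b = v" using dom by simp
    \<comment> \<open>\<open>w\<close> dominates the complete part and \<open>a\<close> covers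
      itself, while neither is the full vertex \<open>b\<close>.\<close>
    have pair: "coalition G {w} {a}" if w: "w \<in> pverts G - {a, b}" for w
      using w a b E dom \<open>b = v\<close> by (auto simp: coalition_def dominating_set_def)
    \<comment> \<open>The block \<open>{a}\<close> also needs a partner; \<open>n \<ge> 3\<close>
      supplies a third vertex.\<close>
    obtain c where c: "c \<in> pverts G - {a, b}"
      using ex_in_Diff_doubleton[of "pverts G" a b] assms(2,3) by blast
    have "coalition G {a} {c}"
      using pair[OF c] by (simp add: coalition_def Int_commute insert_commute)
    then show "coalition_partition G ((\<lambda>x. {x}) ` pverts G)"
      unfolding coalition_partition_singletons_iff using a c pair dom \<open>b = v\<close> by blast
  qed
  finally show ?thesis .
qed

end
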